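(* Let $G=(V,E)$ be a finite directed graph (loops and multiple edges allowed) in which every vertex has indegree greater than $0$. Let $\{x_e\}_{e\in E}$ be commuting indeterminates indexed by the edges of $G$. Then \[\kappa^{vertex}(\mathcal{L}G)=\kappa^{edge}(G)\prod_{v\in V}\Big(\sum_{e\in E:\ s(e)=v} x_e\Big)^{\mathrm{indeg}(v)-1}.\]
   Context: Each edge $e$ of a directed graph is directed from its source $s(e)$ to its target $t(e)$. The directed line graph $\mathcal{L}G$ has vertex set $E$ and one edge $(e,f)$ for every ordered pair of edges $e,f$ of $G$ with $t(e)=s(f)$. An oriented spanning tree of a directed graph $H$ with a distinguished vertex $r$ (the root) is a subgraph of $H$ containing all vertices of $H$ in which every vertex has a unique directed path to $r$ (equivalently: it is acyclic, the root has outdegree $0$ and every other vertex has outdegree $1$). For a directed graph $H=(W,F)$ with indeterminates $x_w$ ($w\in W$) and $x_f$ ($f\in F$), define $\kappa^{edge}(H)=\sum_T\prod_{f\in T}x_f$ and $\kappa^{vertex}(H)=\sum_T\prod_{f\in T}x_{t(f)}$, where $T$ ranges over all oriented spanning trees of $H$ (with all possible roots) and the products are over the edges of $T$. For $H=\mathcal{L}G$ the vertex variables are the $x_e$, $e\in E$, so an edge $(e,f)$ of $\mathcal{L}G$ contributes $x_f$ to $\kappa^{vertex}(\mathcal{L}G)$. *)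

theory Defs
  imports
    "Graph_Theory.Graph_Theory"
    "HOL-Library.Poly_Mapping"
begin

text \<open>
  Polynomials with integer coefficients in commuting indeterminates indexed by \<open>'i\<close>: finitely
  supported maps from monomials (exponent vectors \<open>'i \<Rightarrow>\<^sub>0 nat\<close>) to coefficients.  The
  multiplication that \<open>HOL-Library.Poly_Mapping\<close> puts on this type is the convolution product,
  i.e. multiplication of polynomials.
\<close>

type_synonym 'i int_mpoly = "('i \<Rightarrow>\<^sub>0 nat) \<Rightarrow>\<^sub>0 int"

definition indet :: "'i \<Rightarrow> 'i int_mpoly" where
  "indet i = Poly_Mapping.single (Poly_Mapping.single i 1) 1"

definition line_digraph :: "('a, 'b) pre_digraph \<Rightarrow> ('b, 'b \<times> 'b) pre_digraph" where
  "line_digraph G =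
     \<lparr> verts = arcs G,
       arcs = {(e, f). e \<in> arcs G \<and> f \<in> arcs G \<and> head G e = tail G f},
       tail = fst,
       head = snd \<rparr>"

text \<open>
  The unique directed path to the root is a unique \<^emph>\<open>walk\<close> (possibly empty).  Uniqueness among
  simple paths (\<open>apath\<close>) would be too weak: it would allow loops, and arcs leaving the root.
\<close>

definition oriented_spanning_tree ::
    "('a, 'b) pre_digraph \<Rightarrow> 'a \<Rightarrow> ('a, 'b) pre_digraph \<Rightarrow> bool" where
  "oriented_spanning_tree H r T \<longleftrightarrow>
     spanning T H \<and> r \<in> verts T \<and> (\<forall>v \<in> verts T. \<exists>!p. pre_digraph.awalk T v p r)"

text \<open>
  The root of an oriented spanning tree is determined by the tree (it is the only vertex of
  outdegree 0), so summing over trees is the same as summing over pairs of a root and a tree.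
\<close>

definition oriented_spanning_trees :: "('a, 'b) pre_digraph \<Rightarrow> ('a, 'b) pre_digraph set" where
  "oriented_spanning_trees H = {T. \<exists>r \<in> verts H. oriented_spanning_tree H r T}"

definition kappa_edge :: "('a, 'b) pre_digraph \<Rightarrow> 'b int_mpoly" where
  "kappa_edge H = (\<Sum>T \<in> oriented_spanning_trees H. \<Prod>f \<in> arcs T. indet f)"

definition kappa_vertex :: "('a, 'b) pre_digraph \<Rightarrow> 'a int_mpoly" where
  "kappa_vertex H = (\<Sum>T \<in> oriented_spanning_trees H. \<Prod>f \<in> arcs T. indet (head H f))"

end

theory Submission
  imports Defs
begin

text \<open>
  Two edges \<open>e\<close> and \<open>e'\<close> of \<open>G\<close> with the same target \<open>v\<close> have the same weighted out-arcs in the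
  line graph, with total weight \<open>S = (\<Sum>f \<in> out_arcs G v. x\<^sub>f)\<close>.  The tree sum of a weighted
  digraph with two such vertices \<open>u\<close>, \<open>u'\<close> is \<open>S\<close> times the tree sum after identifying them; identifying all edges with
  the same target turns the line graph into \<open>G\<close> and produces the factor \<open>S ^ (indeg v - 1)\<close>.

  To see the effect of one identification, fix the out-arcs of all vertices other than \<open>u\<close> and
  \<open>u'\<close>, and let \<open>d\<close> and \<open>d'\<close> be the weights of the out-arcs of \<open>u\<close> (equivalently of \<open>u'\<close>) whose
  heads lead to \<open>u\<close> and \<open>u'\<close>.  If the root is another vertex, the admissible choices at
  \<open>u\<close> and \<open>u'\<close> have weight \<open>(S - d) * (S - d') - d * d' = S * (S - d - d')\<close>, where \<open>S - d - d'\<close> is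
  the weight of the admissible choices at the merged vertex.  If the root is \<open>u\<close> or \<open>u'\<close>, they
  have weight \<open>(S - d') + (S - d) = S\<close>, because every other vertex leads to \<open>u\<close> or to \<open>u'\<close>.
\<close>

section \<open>Merging vertices with the same out-arcs\<close>

text \<open>
  A rooted tree on \<open>W\<close> with root \<open>r\<close> is encoded by the function that assigns to each vertex in
  \<open>W - {r}\<close> its outgoing arc.  Arcs are mere labels: \<open>B x\<close> are the labels available at \<open>x\<close> and
  \<open>h b\<close> is the head of \<open>b\<close>, so that different vertices may share the same labels, and
  identifying vertices changes \<open>h\<close> only.
\<close>

definition succ_rel :: "'a set \<Rightarrow> ('b \<Rightarrow> 'a) \<Rightarrow> ('a \<Rightarrow> 'b) \<Rightarrow> 'a rel" where
  "succ_rel X h f = (\<lambda>x. (x, h (f x))) ` X"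

definition acyclic_choices :: "'a set \<Rightarrow> ('a \<Rightarrow> 'b set) \<Rightarrow> ('b \<Rightarrow> 'a) \<Rightarrow> ('a \<Rightarrow> 'b) set" where
  "acyclic_choices X B h = {f \<in> Pi\<^sub>E X B. acyclic (succ_rel X h f)}"

text \<open>The vertices outside \<open>X\<close> make no choice and act as sinks. Deleting two or
  three vertices at once therefore makes sense too; such sums arise when the choices at
  \<open>u\<close> and \<open>u'\<close> are split off.\<close>

definition forest_sum ::
    "'a set \<Rightarrow> ('a \<Rightarrow> 'b set) \<Rightarrow> ('b \<Rightarrow> 'a) \<Rightarrow> ('b \<Rightarrow> 'c::comm_ring_1) \<Rightarrow> 'c" where
  "forest_sum X B h w = (\<Sum>f \<in> acyclic_choices X B h. \<Prod>x \<in> X. w (f x))"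

definition tree_sum ::
    "'a set \<Rightarrow> ('a \<Rightarrow> 'b set) \<Rightarrow> ('b \<Rightarrow> 'a) \<Rightarrow> ('b \<Rightarrow> 'c::comm_ring_1) \<Rightarrow> 'c" where
  "tree_sum W B h w = (\<Sum>r \<in> W. forest_sum (W - {r}) B h w)"

section \<open>Walks of choice functions and extension by one vertex\<close>

lemma succ_rel_iff: "(x, y) \<in> succ_rel X h f \<longleftrightarrow> x \<in> X \<and> y = h (f x)"
  by (auto simp: succ_rel_def)

lemma single_valued_succ_rel: "single_valued (succ_rel X h f)"
  by (auto simp: single_valued_def succ_rel_iff)

lemma succ_rel_insert:
  "u \<notin> X \<Longrightarrow> succ_rel (insert u X) h (f(u := b)) = insert (u, h b) (succ_rel X h f)"
  by (auto simp: succ_rel_def)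

lemma succ_rel_rtrancl_outside:
  assumes "(x, y) \<in> (succ_rel X h f)\<^sup>*" "x \<notin> X"
  shows "y = x"
  using assms by (auto elim: converse_rtranclE simp: succ_rel_iff)

lemma succ_rel_sink_unique:
  assumes "(x, y) \<in> (succ_rel X h f)\<^sup>*" "(x, z) \<in> (succ_rel X h f)\<^sup>*" "y \<notin> X" "z \<notin> X"
  shows "y = z"
  using single_valued_confluent[OF single_valued_succ_rel assms(1,2)]
    succ_rel_rtrancl_outside assms(3,4) by metis

text \<open>A finite acyclic relation is well-founded along its arcs, so a walk cannot stay in
  \<open>X\<close> forever, and the only exits lead to \<open>Z\<close>.\<close>

lemma succ_rel_reaches_sink:
  assumes "finite X" "acyclic (succ_rel X h f)"
    and closed: "\<And>x. x \<in> X \<Longrightarrow> h (f x) \<in> X \<union> Z" and "x \<in> X \<union> Z"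
  shows "\<exists>z \<in> Z. (x, z) \<in> (succ_rel X h f)\<^sup>*"
proof -
  have "wf ((succ_rel X h f)\<inverse>)"
    using assms(1,2) by (intro finite_acyclic_wf_converse) (auto simp: succ_rel_def)
  then show ?thesis using \<open>x \<in> X \<union> Z\<close>
  proof (induction x rule: wf_induct_rule)
    case (less x)
    show ?case
    proof (cases "x \<in> X")
      case True
      then have step: "(x, h (f x)) \<in> succ_rel X h f" by (simp add: succ_rel_iff)
      then obtain z where "z \<in> Z" "(h (f x), z) \<in> (succ_rel X h f)\<^sup>*"
        using less.IH[of "h (f x)"] closed[OF True] by auto
      then show ?thesis using step converse_rtrancl_into_rtrancl by metis
    next
      case False
      then show ?thesis using less.prems by auto
    qed
  qed
qed

lemma finite_acyclic_choices:
  "finite X \<Longrightarrow> (\<And>x. x \<in> X \<Longrightarrow> finite (B x)) \<Longrightarrow> finite (acyclic_choices X B h)"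
  by (simp add: acyclic_choices_def finite_PiE)

text \<open>The out-arc of \<open>u\<close> is chosen last. A new arc from \<open>u\<close> to
  \<open>h b\<close> closes a cycle exactly if \<open>h b\<close> already leads to
  \<open>u\<close>.\<close>

lemma sum_acyclic_choices_insert:
  fixes \<phi> :: "('a \<Rightarrow> 'b) \<Rightarrow> 'c::comm_ring_1"
  assumes "finite X" "u \<notin> X" and fin: "\<And>x. x \<in> insert u X \<Longrightarrow> finite (B x)"
  shows "sum \<phi> (acyclic_choices (insert u X) B h) =
    (\<Sum>g \<in> acyclic_choices X B h.
      \<Sum>b \<in> {b \<in> B u. (h b, u) \<notin> (succ_rel X h g)\<^sup>*}. \<phi> (g(u := b)))"
proof -
  let ?S = "SIGMA g:acyclic_choices X B h. {b \<in> B u. (h b, u) \<notin> (succ_rel X h g)\<^sup>*}"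
  have img: "acyclic_choices (insert u X) B h = (\<lambda>(g, b). g(u := b)) ` ?S"
    using \<open>u \<notin> X\<close>
    by (auto simp: acyclic_choices_def PiE_insert_eq succ_rel_insert acyclic_insert
        image_iff)
  have inj: "inj_on (\<lambda>(g, b). g(u := b)) ?S"
  proof (rule inj_onI, clarify)
    fix g b g' b'
    assume g: "g \<in> acyclic_choices X B h" "g' \<in> acyclic_choices X B h"
      and eq: "g(u := b) = g'(u := b')"
    \<comment> \<open>Both functions are extensional, so they take the default value at
      \<open>u\<close>, which lies outside \<open>X\<close>.\<close>
    have "g u = g' u"
      using g \<open>u \<notin> X\<close> by (simp add: acyclic_choices_def PiE_arb[of _ X B])
    then show "g = g' \<and> b = b'" using eq by (metis fun_upd_eqD fun_upd_triv fun_upd_upd)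
  qed
  have "sum \<phi> (acyclic_choices (insert u X) B h) = (\<Sum>(g, b) \<in> ?S. \<phi> (g(u := b)))"
    unfolding img by (subst sum.reindex[OF inj]) (auto intro!: sum.cong)
  then show ?thesis
    using finite_acyclic_choices assms(1) fin by (subst sum.Sigma) auto
qed

lemma prod_fun_upd:
  fixes w :: "'b \<Rightarrow> 'c::comm_monoid_mult"
  shows "finite X \<Longrightarrow> u \<notin> X \<Longrightarrow>
    (\<Prod>x \<in> insert u X. w ((g(u := b)) x)) = w b * (\<Prod>x \<in> X. w (g x))"
  by (auto intro!: arg_cong2[where f = "(*)"] prod.cong)

section \<open>Identifying two vertices that share their labels\<close>

locale merge_vertices =
  fixes X :: "'a set" and u u' :: 'a
  assumes finite_X: "finite X" and u_notin: "u \<notin> X" and u'_notin: "u' \<notin> X" and neq: "u \<noteq> u'"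
begin

abbreviation m :: "'a \<Rightarrow> 'a" where "m \<equiv> id(u' := u)"

text \<open>All vertices of a cycle have an out-arc, hence lie in \<open>X\<close>, while
  \<open>m\<close> only redirects arcs whose head is \<open>u'\<close>, outside
  \<open>X\<close>.\<close>

lemma merge_acyclic_iff:
  "acyclic (succ_rel X (m \<circ> h) g) \<longleftrightarrow> acyclic (succ_rel X h g)"
proof -
  have inner: "acyclic R \<longleftrightarrow> acyclic (R \<inter> X \<times> X)" if dom: "Domain R \<subseteq> X" for R :: "'a rel"
  proof
    assume a: "acyclic (R \<inter> X \<times> X)"
    have "(x, y) \<in> (R \<inter> X \<times> X)\<^sup>+" if "(x, y) \<in> R\<^sup>+" "y \<in> X" for x y
      using that
    proof (induction rule: trancl_induct)
      case (base y)
      then show ?case using dom by blast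
    next
      case (step y z)
      have "y \<in> X" using dom step(2) by auto
      then have "(y, z) \<in> R \<inter> X \<times> X" using step by auto
      then show ?case using step \<open>y \<in> X\<close> by (meson trancl.trancl_into_trancl)
    qed
    moreover have "x \<in> X" if "(x, x) \<in> R\<^sup>+" for x
      using that dom by (meson DomainI subsetD tranclD)
    ultimately show "acyclic R" using a unfolding acyclic_def by blast
  qed (auto intro: acyclic_subset)
  have "succ_rel X (m \<circ> h) g \<inter> X \<times> X = succ_rel X h g \<inter> X \<times> X"
    using u_notin u'_notin by (auto simp: succ_rel_def split: if_splits)
  moreover have "Domain (succ_rel X h' g) \<subseteq> X" for h' by (auto simp: succ_rel_def)
  ultimately show ?thesis by (metis inner)
qed

text \<open>\<open>m\<close> maps walks to walks. Conversely, a walk to the merged vertex stays in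
  \<open>X\<close>, where \<open>m\<close> is the identity, until its last arc, which originally
  ended in \<open>u\<close> or in \<open>u'\<close>.\<close>

lemma merge_reaches_iff:
  "(m y, u) \<in> (succ_rel X (m \<circ> h) g)\<^sup>* \<longleftrightarrow>
    (y, u) \<in> (succ_rel X h g)\<^sup>* \<or> (y, u') \<in> (succ_rel X h g)\<^sup>*" (is "?L \<longleftrightarrow> ?R")
proof
  have *: "(m y, m z) \<in> (succ_rel X (m \<circ> h) g)\<^sup>*" if "(y, z) \<in> (succ_rel X h g)\<^sup>*" for z
    using that
  proof (induction rule: rtrancl_induct)
    case (step z z')
    then have "(m z, m z') \<in> succ_rel X (m \<circ> h) g" using u'_notin by (auto simp: succ_rel_iff)
    then show ?case using step by (meson rtrancl.rtrancl_into_rtrancl)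
  qed simp
  show ?L if ?R using that *[of u] *[of u'] neq by auto
  have "(y, u) \<in> (succ_rel X h g)\<^sup>* \<or> (y, u') \<in> (succ_rel X h g)\<^sup>*"
    if "(x, u) \<in> (succ_rel X (m \<circ> h) g)\<^sup>*" "m y = x" for x y
    using that
  proof (induction arbitrary: y rule: converse_rtrancl_induct)
    case base
    then show ?case by (auto split: if_splits)
  next
    case (step x x')
    then have x: "x \<in> X" "x' = m (h (g x))" by (auto simp: succ_rel_iff)
    then have "y = x" using step.prems u_notin by (auto split: if_splits)
    then have "(y, h (g x)) \<in> succ_rel X h g" using x by (simp add: succ_rel_iff)
    then show ?case using step.IH[of "h (g x)"] x
      by (meson converse_rtrancl_into_rtrancl)
  qed
  then show ?R if ?L using that by blast
qed

lemma merge_acyclic_choices: "acyclic_choices X B (m \<circ> h) = acyclic_choices X B h"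
  by (simp only: acyclic_choices_def merge_acyclic_iff)

text \<open>This is the case of a root other than \<open>u\<close> and \<open>u'\<close>. The
  choices on \<open>X\<close> are fixed as \<open>g\<close>, then \<open>b1\<close> is chosen at
  \<open>u\<close> and finally \<open>b2\<close> at \<open>u'\<close>.\<close>

lemma forest_sum_merge:
  fixes w :: "'b \<Rightarrow> 'c::comm_ring_1"
  assumes fin: "\<And>x. x \<in> insert u X \<Longrightarrow> finite (B x)" and B: "B u' = B u"
  shows "forest_sum (insert u' (insert u X)) B h w =
    sum w (B u) * forest_sum (insert u X) B (m \<circ> h) w"
proof -
  have finB: "finite (B u)" using fin by simp
  have u'2: "u' \<notin> insert u X" and fin2: "finite (insert u X)"
    and fin3: "\<And>x. x \<in> insert u' (insert u X) \<Longrightarrow> finite (B x)"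
    using u'_notin neq finite_X fin B by auto
  define P where "P g = (\<Prod>x \<in> X. w (g x))" for g
  define S where "S = sum w (B u)"
  define D where "D g = {b \<in> B u. (h b, u) \<in> (succ_rel X h g)\<^sup>*}" for g
  define D' where "D' g = {b \<in> B u. (h b, u') \<in> (succ_rel X h g)\<^sup>*}" for g
  \<comment> \<open>Both \<open>u\<close> and \<open>u'\<close> are sinks for \<open>g\<close>, and
    a walk ends in at most one sink.\<close>
  have disj: "D g \<inter> D' g = {}" for g
    using succ_rel_sink_unique[of _ u X h g u'] u_notin u'_notin neq by (auto simp: D_def D'_def)
  have sub: "D g \<subseteq> B u" "D' g \<subseteq> B u" for g by (auto simp: D_def D'_def)
  have finD: "finite (D g)" "finite (D' g)" for g
    using sub finB finite_subset by metis+
  have sum_diff2: "sum w (B u - D' g - D g) = S - sum w (D' g) - sum w (D g)" for g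
  proof -
    have "D g \<subseteq> B u - D' g" using disj sub by blast
    then show ?thesis using sub finB by (simp add: sum_diff S_def)
  qed
  \<comment> \<open>The head of \<open>b2\<close> must not lead to \<open>u'\<close>, either
    directly (\<open>D' g\<close>) or through \<open>u\<close>. The detour through \<open>u\<close>
    exists only if \<open>b1\<close> leads from \<open>u\<close> to \<open>u'\<close>, and then it
    rules out \<open>D g\<close> as well.\<close>
  have inner: "(\<Sum>b2 \<in> {b \<in> B u'. (h b, u') \<notin> (succ_rel (insert u X) h (g(u := b1)))\<^sup>*}.
        \<Prod>x \<in> insert u' (insert u X). w ((g(u := b1, u' := b2)) x)) =
      w b1 * P g * (S - sum w (D' g) - (if b1 \<in> D' g then sum w (D g) else 0))"
    if b1: "b1 \<in> B u - D g" for g b1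
  proof -
    have "{b \<in> B u'. (h b, u') \<notin> (succ_rel (insert u X) h (g(u := b1)))\<^sup>*} =
        B u - D' g - (if b1 \<in> D' g then D g else {})"
      using b1 u_notin by (auto simp: succ_rel_insert rtrancl_insert B D_def D'_def)
    moreover have "sum w (B u - D' g - (if b1 \<in> D' g then D g else {})) =
        S - sum w (D' g) - (if b1 \<in> D' g then sum w (D g) else 0)"
      using sub finB by (simp add: sum_diff2) (simp add: sum_diff S_def)
    moreover have "(\<Prod>x \<in> insert u' (insert u X). w ((g(u := b1, u' := b2)) x)) =
        w b1 * P g * w b2" for b2
      by (subst prod_fun_upd[OF fin2 u'2], subst prod_fun_upd[OF finite_X u_notin])
        (simp add: P_def ac_simps)
    ultimately show ?thesis by (simp only: flip: sum_distrib_left)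
  qed
  have "forest_sum (insert u' (insert u X)) B h w =
      (\<Sum>g \<in> acyclic_choices X B h. \<Sum>b1 \<in> B u - D g.
        w b1 * P g * (S - sum w (D' g) - (if b1 \<in> D' g then sum w (D g) else 0)))"
    unfolding forest_sum_def
    apply (subst sum_acyclic_choices_insert[OF fin2 u'2 fin3], assumption)
    apply (subst sum_acyclic_choices_insert[OF finite_X u_notin fin], assumption)
    using inner by (intro sum.cong) (auto simp: D_def)
  also have "\<dots> = (\<Sum>g \<in> acyclic_choices X B h. S * ((S - sum w (D g) - sum w (D' g)) * P g))"
  proof (rule sum.cong[OF refl])
    \<comment> \<open>With \<open>d = sum w (D g)\<close> and \<open>d' = sum w (D' g)\<close>:
      \<open>(S - d') * (S - d) - d' * d = S * (S - d - d')\<close>.\<close>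
    fix g
    have "(\<Sum>b1 \<in> B u - D g. w b1 * (if b1 \<in> D' g then sum w (D g) else 0)) =
        (\<Sum>b1 \<in> D' g. w b1 * sum w (D g))"
      using disj[of g] sub[of g] finB by (intro sum.mono_neutral_cong_right) auto
    also have "\<dots> = sum w (D' g) * sum w (D g)" by (simp add: sum_distrib_right)
    finally have 1: "(\<Sum>b1 \<in> B u - D g. w b1 * (if b1 \<in> D' g then sum w (D g) else 0)) =
      sum w (D' g) * sum w (D g)" .
    have 2: "sum w (B u - D g) = S - sum w (D g)"
      using sub finB by (simp add: S_def sum_diff)
    have "(\<Sum>b1 \<in> B u - D g.
          w b1 * P g * (S - sum w (D' g) - (if b1 \<in> D' g then sum w (D g) else 0))) =
        (\<Sum>b1 \<in> B u - D g. P g * (S - sum w (D' g)) * w b1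
          - P g * (w b1 * (if b1 \<in> D' g then sum w (D g) else 0)))"
      by (intro sum.cong) (simp_all add: algebra_simps)
    also have "\<dots> = P g * (S - sum w (D' g)) * (S - sum w (D g))
        - P g * (sum w (D' g) * sum w (D g))"
      by (simp only: sum_subtractf 1 2 flip: sum_distrib_left)
    also have "\<dots> = S * ((S - sum w (D g) - sum w (D' g)) * P g)"
      by (simp add: algebra_simps)
    finally show "(\<Sum>b1 \<in> B u - D g.
          w b1 * P g * (S - sum w (D' g) - (if b1 \<in> D' g then sum w (D g) else 0))) =
        S * ((S - sum w (D g) - sum w (D' g)) * P g)" .
  qed
  also have "\<dots> = S * forest_sum (insert u X) B (m \<circ> h) w"
  proof -
    \<comment> \<open>At the merged vertex the forbidden labels are those leading to
      \<open>u\<close> or to \<open>u'\<close>, the disjoint union of \<open>D g\<close> and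
      \<open>D' g\<close>.\<close>
    have "(\<Sum>b \<in> {b \<in> B u. ((m \<circ> h) b, u) \<notin> (succ_rel X (m \<circ> h) g)\<^sup>*}.
        \<Prod>x \<in> insert u X. w ((g(u := b)) x)) = (S - sum w (D g) - sum w (D' g)) * P g" for g
    proof -
      have "{b \<in> B u. ((m \<circ> h) b, u) \<notin> (succ_rel X (m \<circ> h) g)\<^sup>*} = B u - D' g - D g"
        by (simp only: comp_apply[of m h] merge_reaches_iff) (auto simp: D_def D'_def)
      moreover have "sum w (B u - D' g - D g) = S - sum w (D g) - sum w (D' g)"
        by (simp add: sum_diff2)
      ultimately show ?thesis
        by (simp only: prod_fun_upd[OF finite_X u_notin] flip: sum_distrib_right P_def)
    qed
    then show ?thesis
      unfolding forest_sum_def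
      by (subst sum_acyclic_choices_insert[OF finite_X u_notin fin])
        (simp_all only: merge_acyclic_choices sum_distrib_left)
  qed
  finally show ?thesis by (simp add: S_def)
qed

text \<open>The two summands have root \<open>u'\<close> and root \<open>u\<close>, respectively.
  After merging, the common vertex is the root and makes no choice, so only \<open>X\<close> remains
  on the right.\<close>

lemma forest_sum_merge_root:
  fixes w :: "'b \<Rightarrow> 'c::comm_ring_1"
  assumes fin: "\<And>x. x \<in> insert u X \<Longrightarrow> finite (B x)" and B: "B u' = B u"
    and h: "\<And>x b. x \<in> insert u X \<Longrightarrow> b \<in> B x \<Longrightarrow> h b \<in> X \<union> {u, u'}"
  shows "forest_sum (insert u X) B h w + forest_sum (insert u' X) B h w =
    sum w (B u) * forest_sum X B (m \<circ> h) w"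
proof -
  have finB: "finite (B u)" using fin by simp
  \<comment> \<open>In contrast to \<open>forest_sum_merge\<close>, these are the admissible labels.
    As every head leads to exactly one of \<open>u\<close> and \<open>u'\<close>, the sets
    \<open>D u g\<close> and \<open>D u' g\<close> partition \<open>B u\<close>.\<close>
  define D where "D z g = {b \<in> B u. (h b, z) \<notin> (succ_rel X h g)\<^sup>*}" for z g
  have one: "forest_sum (insert z X) B h w =
      (\<Sum>g \<in> acyclic_choices X B h. sum w (D z g) * (\<Prod>x \<in> X. w (g x)))" if z: "z \<in> {u, u'}" for z
  proof -
    have zX: "z \<notin> X" and finz: "\<And>x. x \<in> insert z X \<Longrightarrow> finite (B x)" and Bz: "B z = B u"
      using z u_notin u'_notin fin B by auto
    show ?thesis
      unfolding forest_sum_def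
      by (subst sum_acyclic_choices_insert[OF finite_X zX finz])
        (simp_all only: prod_fun_upd[OF finite_X zX] D_def Bz sum_distrib_right)
  qed
  have "sum w (D u g) + sum w (D u' g) = sum w (B u)" if g: "g \<in> acyclic_choices X B h" for g
  proof -
    have "D u g \<inter> D u' g = {}"
    proof (rule ccontr)
      assume "D u g \<inter> D u' g \<noteq> {}"
      then obtain b where b: "b \<in> B u" "b \<in> D u g" "b \<in> D u' g" by (auto simp: D_def)
      have "\<exists>z \<in> {u, u'}. (h b, z) \<in> (succ_rel X h g)\<^sup>*"
        using g h b(1) by (intro succ_rel_reaches_sink[OF finite_X])
          (auto simp: acyclic_choices_def PiE_mem)
      then show False using b by (auto simp: D_def)
    qed
    moreover have "D u g \<union> D u' g = B u"
      using succ_rel_sink_unique[of _ u X h g u'] u_notin u'_notin neq by (auto simp: D_def)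
    moreover have "finite (D u g)" "finite (D u' g)" using finB by (auto simp: D_def)
    ultimately show ?thesis by (metis sum.union_disjoint)
  qed
  then have "forest_sum (insert u X) B h w + forest_sum (insert u' X) B h w =
      (\<Sum>g \<in> acyclic_choices X B h. sum w (B u) * (\<Prod>x \<in> X. w (g x)))"
    by (simp add: one flip: sum.distrib distrib_right)
  then show ?thesis
    by (simp add: forest_sum_def merge_acyclic_choices sum_distrib_left)
qed

end

text \<open>The roots \<open>u\<close> and \<open>u'\<close> jointly account for the merged root
  \<open>u\<close>; any other root \<open>r\<close> is matched with itself.\<close>

lemma tree_sum_merge:
  fixes w :: "'b \<Rightarrow> 'c::comm_ring_1"
  assumes W: "finite W" and u: "u \<in> W" and u': "u' \<in> W" and neq: "u \<noteq> u'"
    and fin: "\<And>x. x \<in> W \<Longrightarrow> finite (B x)" and B: "B u' = B u"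
    and h: "\<And>x b. x \<in> W \<Longrightarrow> b \<in> B x \<Longrightarrow> h b \<in> W"
  shows "tree_sum W B h w = sum w (B u) * tree_sum (W - {u'}) B (id(u' := u) \<circ> h) w"
proof -
  define R where "R = W - {u, u'}"
  have R: "finite R" "u \<notin> R" "u' \<notin> R" using W by (auto simp: R_def)
  have WR: "W = insert u (insert u' R)" and WR': "W - {u'} = insert u R"
    using u u' neq by (auto simp: R_def)
  have root: "forest_sum (W - {u}) B h w + forest_sum (W - {u'}) B h w =
      sum w (B u) * forest_sum R B (id(u' := u) \<circ> h) w"
  proof -
    interpret merge_vertices R u u' using R neq by unfold_locales
    have "W - {u} = insert u' R" using u u' neq by (auto simp: R_def)
    moreover have "finite (B x)" if "x \<in> insert u R" for x using that fin u by (auto simp: R_def)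
    moreover have "h b \<in> R \<union> {u, u'}" if "x \<in> insert u R" "b \<in> B x" for x b
      using that h[of x b] u by (auto simp: R_def)
    ultimately show ?thesis
      using forest_sum_merge_root[of B h w] B by (simp add: WR' add.commute)
  qed
  have other: "forest_sum (W - {r}) B h w =
      sum w (B u) * forest_sum (insert u R - {r}) B (id(u' := u) \<circ> h) w" if r: "r \<in> R" for r
  proof -
    interpret merge_vertices "R - {r}" u u' using R neq by unfold_locales auto
    have "W - {r} = insert u' (insert u (R - {r}))" "insert u R - {r} = insert u (R - {r})"
      using r u u' by (auto simp: R_def)
    moreover have "finite (B x)" if "x \<in> insert u (R - {r})" for x
      using that fin by (auto simp: WR)
    ultimately show ?thesis using forest_sum_merge[of B h w] B by simp
  qed
  have "tree_sum W B h w = (forest_sum (W - {u}) B h w + forest_sum (W - {u'}) B h w) +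
      (\<Sum>r \<in> R. forest_sum (W - {r}) B h w)"
    unfolding tree_sum_def using R neq by (subst (1) WR) (simp add: add.assoc)
  moreover have "tree_sum (W - {u'}) B (id(u' := u) \<circ> h) w =
      forest_sum R B (id(u' := u) \<circ> h) w +
      (\<Sum>r \<in> R. forest_sum (insert u R - {r}) B (id(u' := u) \<circ> h) w)"
    unfolding tree_sum_def WR' using R by simp
  ultimately show ?thesis by (simp add: root other distrib_left sum_distrib_left)
qed

section \<open>Renaming vertices and passing to a quotient\<close>

lemma acyclic_map_prod_iff:
  assumes inj: "inj_on \<pi> (Field R)"
  shows "acyclic (map_prod \<pi> \<pi> ` R) \<longleftrightarrow> acyclic R"
proof -
  let ?R = "map_prod \<pi> \<pi> ` R"
  have "(\<pi> x, \<pi> y) \<in> ?R\<^sup>+" if "(x, y) \<in> R\<^sup>+" for x y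
    using that
  proof (induction rule: trancl_induct)
    case (step y z)
    then have "(\<pi> y, \<pi> z) \<in> ?R" by force
    then show ?case using step by (meson trancl.trancl_into_trancl)
  qed force
  moreover have "\<exists>x y. (x, y) \<in> R\<^sup>+ \<and> v = \<pi> x \<and> v' = \<pi> y" if "(v, v') \<in> ?R\<^sup>+" for v v'
    using that
  proof (induction rule: trancl_induct)
    case (step v' v'')
    from step.IH obtain x y where "(x, y) \<in> R\<^sup>+" "v = \<pi> x" "v' = \<pi> y" by blast
    moreover from step.hyps(2) obtain y' z where "(y', z) \<in> R" "v' = \<pi> y'" "v'' = \<pi> z"
      by (auto elim: imageE)
    ultimately have *: "(x, y) \<in> R\<^sup>+" "v = \<pi> x" "v' = \<pi> y"
        "(y', z) \<in> R" "v' = \<pi> y'" "v'' = \<pi> z"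
      by auto
    then have "y \<in> Field R" "y' \<in> Field R"
      by (metis FieldI2 tranclD2, metis FieldI1)
    \<comment> \<open>Two consecutive image arcs lift to composable arcs because the vertex they
      share has only one preimage in the field.\<close>
    then have "y = y'" using inj * by (auto dest: inj_onD)
    then have "(x, z) \<in> R\<^sup>+" using * by (simp add: trancl.trancl_into_trancl)
    then show ?case using * by blast
  qed force
  moreover have "x \<in> Field R" "y \<in> Field R" if "(x, y) \<in> R\<^sup>+" for x y
    using that by (meson FieldI1 FieldI2 tranclD tranclD2)+
  ultimately show ?thesis using inj unfolding acyclic_def by (metis inj_onD)
qed

lemma forest_sum_reindex:
  assumes inj: "inj_on \<pi> W" and X: "X \<subseteq> W"
    and h: "\<And>x b. x \<in> X \<Longrightarrow> b \<in> B (\<pi> x) \<Longrightarrow> h b \<in> W"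
  shows "forest_sum X (B \<circ> \<pi>) h w = forest_sum (\<pi> ` X) B (\<pi> \<circ> h) w"
proof -
  have injX: "inj_on \<pi> X" using inj X by (rule inj_on_subset)
  have acyc: "acyclic (succ_rel (\<pi> ` X) (\<pi> \<circ> h) g) \<longleftrightarrow> acyclic (succ_rel X h f)"
    if "f \<in> Pi\<^sub>E X (B \<circ> \<pi>)" "\<And>x. x \<in> X \<Longrightarrow> g (\<pi> x) = f x" for f g
  proof -
    have "succ_rel (\<pi> ` X) (\<pi> \<circ> h) g = map_prod \<pi> \<pi> ` succ_rel X h f"
      using that by (force simp: succ_rel_def image_iff)
    moreover have "Field (succ_rel X h f) \<subseteq> W"
      using that(1) X h by (fastforce simp: Field_def succ_rel_def)
    ultimately show ?thesis using acyclic_map_prod_iff inj_on_subset[OF inj] by metis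
  qed
  let ?i = "\<lambda>g. \<lambda>x\<in>X. g (\<pi> x)" and ?j = "\<lambda>f. \<lambda>v\<in>\<pi> ` X. f (inv_into X \<pi> v)"
  have j: "?j f (\<pi> x) = f x" if "x \<in> X" for f x using that injX by simp
  have i_PiE: "?i g \<in> Pi\<^sub>E X (B \<circ> \<pi>)" if "g \<in> Pi\<^sub>E (\<pi> ` X) B" for g using that by auto
  have j_PiE: "?j f \<in> Pi\<^sub>E (\<pi> ` X) B" if "f \<in> Pi\<^sub>E X (B \<circ> \<pi>)" for f
    using that injX by (auto simp: PiE_iff)
  show ?thesis
    unfolding forest_sum_def
  proof (rule sum.reindex_bij_witness[where i = ?i and j = ?j])
    fix f assume f: "f \<in> acyclic_choices X (B \<circ> \<pi>) h"
    then have "f \<in> extensional X" by (simp add: acyclic_choices_def PiE_def)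
    then show "?i (?j f) = f" using injX by (intro extensionalityI[of _ X]) auto
    have "acyclic (succ_rel (\<pi> ` X) (\<pi> \<circ> h) (?j f)) \<longleftrightarrow> acyclic (succ_rel X h f)"
      by (rule acyc) (use f j in \<open>auto simp: acyclic_choices_def\<close>)
    then show "?j f \<in> acyclic_choices (\<pi> ` X) B (\<pi> \<circ> h)"
      using f j_PiE[of f] by (simp add: acyclic_choices_def)
    show "(\<Prod>x \<in> \<pi> ` X. w (?j f x)) = (\<Prod>x \<in> X. w (f x))"
      using injX by (simp add: prod.reindex)
  next
    fix g assume g: "g \<in> acyclic_choices (\<pi> ` X) B (\<pi> \<circ> h)"
    then have "g \<in> extensional (\<pi> ` X)" by (simp add: acyclic_choices_def PiE_def)
    then show "?j (?i g) = g"
      by (intro extensionalityI[of _ "\<pi> ` X"]) (auto simp: f_inv_into_f inv_into_into injX)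
    show "?i g \<in> acyclic_choices X (B \<circ> \<pi>) h"
      using g i_PiE[of g] acyc[of "?i g" g] by (simp add: acyclic_choices_def)
  qed
qed

text \<open>The vertices in a fibre of \<open>\<pi>\<close> share their labels, so they can be
  merged pair by pair until \<open>\<pi>\<close> is injective; what remains is a renaming. Since
  merging changes the heads, the induction generalizes over \<open>h\<close>.\<close>

theorem tree_sum_quotient:
  fixes w :: "'b \<Rightarrow> 'c::comm_ring_1"
  assumes "finite W" and "\<And>x. x \<in> W \<Longrightarrow> finite (B (\<pi> x))"
    and "\<And>x b. x \<in> W \<Longrightarrow> b \<in> B (\<pi> x) \<Longrightarrow> h b \<in> W"
  shows "tree_sum W (B \<circ> \<pi>) h w =
    (\<Prod>v \<in> \<pi> ` W. sum w (B v) ^ (card {x \<in> W. \<pi> x = v} - 1)) * tree_sum (\<pi> ` W) B (\<pi> \<circ> h) w"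
  using assms
proof (induction "card W" arbitrary: W h rule: less_induct)
  case less
  show ?case
  proof (cases "inj_on \<pi> W")
    case True
    have "card {x \<in> W. \<pi> x = v} = 1" if "v \<in> \<pi> ` W" for v
    proof -
      from that obtain x where "x \<in> W" "v = \<pi> x" by blast
      then have "{x \<in> W. \<pi> x = v} = {x}" using True by (auto dest: inj_onD)
      then show ?thesis by simp
    qed
    moreover have "tree_sum (\<pi> ` W) B (\<pi> \<circ> h) w = tree_sum W (B \<circ> \<pi>) h w"
    proof -
      have "\<pi> ` W - {\<pi> r} = \<pi> ` (W - {r})" if "r \<in> W" for r
        using True that by (auto dest: inj_onD)
      moreover have "forest_sum (W - {r}) (B \<circ> \<pi>) h w = forest_sum (\<pi> ` (W - {r})) B (\<pi> \<circ> h) w" for r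
        by (rule forest_sum_reindex[OF True]) (use less.prems in auto)
      ultimately show ?thesis by (simp add: tree_sum_def sum.reindex[OF True])
    qed
    ultimately show ?thesis by simp
  next
    case False
    then obtain u u' where u: "u \<in> W" "u' \<in> W" "u \<noteq> u'" "\<pi> u' = \<pi> u"
      by (auto simp: inj_on_def)
    let ?W = "W - {u'}" and ?h = "id(u' := u) \<circ> h"
    have img: "\<pi> ` ?W = \<pi> ` W" using u by (auto simp: image_iff)
    \<comment> \<open>As \<open>u\<close> and \<open>u'\<close> lie in one fibre, the merge does not
      affect the final quotient.\<close>
    have "\<pi> \<circ> ?h = \<pi> \<circ> h" using u by auto
    moreover have "card ?W < card W" using u less.prems(1) by (meson card_Diff1_less)
    moreover have "?h b \<in> ?W" if "x \<in> ?W" "b \<in> B (\<pi> x)" for x b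
      using that less.prems(3) u by auto
    ultimately have IH: "tree_sum ?W (B \<circ> \<pi>) ?h w =
        (\<Prod>v \<in> \<pi> ` W. sum w (B v) ^ (card {x \<in> ?W. \<pi> x = v} - 1)) *
          tree_sum (\<pi> ` W) B (\<pi> \<circ> h) w"
      using less.hyps[of ?W ?h] less.prems(1,2) by (simp add: img)
    define e where "e v = card {x \<in> W. \<pi> x = v} - 1" for v
    define e' where "e' v = card {x \<in> ?W. \<pi> x = v} - 1" for v
    have e_other: "e v = e' v" if "v \<noteq> \<pi> u" for v
    proof -
      have "{x \<in> W. \<pi> x = v} = {x \<in> ?W. \<pi> x = v}" using that u by auto
      then show ?thesis by (simp add: e_def e'_def)
    qed
    \<comment> \<open>The smaller fibre still contains \<open>u\<close>, so the subtraction in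
      \<open>e'\<close> is not truncated.\<close>
    have e_u: "e (\<pi> u) = Suc (e' (\<pi> u))"
    proof -
      have "{x \<in> W. \<pi> x = \<pi> u} = insert u' {x \<in> ?W. \<pi> x = \<pi> u}" using u by auto
      moreover have "card {x \<in> ?W. \<pi> x = \<pi> u} > 0"
        using u less.prems(1) by (auto simp: card_gt_0_iff)
      ultimately show ?thesis using less.prems(1) by (simp add: e_def e'_def)
    qed
    have "(\<Prod>v \<in> \<pi> ` W. sum w (B v) ^ e v) =
        sum w (B (\<pi> u)) * (\<Prod>v \<in> \<pi> ` W. sum w (B v) ^ e' v)"
      using u(1) less.prems(1) e_u e_other
      by (simp add: prod.remove[of "\<pi> ` W" "\<pi> u"] mult.assoc)
    moreover have "tree_sum W (B \<circ> \<pi>) h w =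
        sum w (B (\<pi> u)) * tree_sum ?W (B \<circ> \<pi>) ?h w"
      using tree_sum_merge[of W u u' "B \<circ> \<pi>" h w] u less.prems by simp
    ultimately show ?thesis unfolding IH e_def e'_def by (simp add: mult.assoc)
  qed
qed

section \<open>Oriented spanning trees as choice functions\<close>

text \<open>Walks to \<open>r\<close> exist because \<open>r\<close> is the only sink. They are
  unique because \<open>f\<close> fixes the arc leaving each vertex and no arc leaves
  \<open>r\<close>.\<close>

lemma oriented_spanning_treeI:
  fixes H :: "('a, 'b) pre_digraph"
  assumes "wf_digraph H" "finite (verts H)" and r: "r \<in> verts H"
    and f: "f \<in> acyclic_choices (verts H - {r}) (out_arcs H) (head H)"
  shows "oriented_spanning_tree H r (H\<lparr>arcs := f ` (verts H - {r})\<rparr>)" (is "oriented_spanning_tree H r ?T")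
proof -
  interpret H: wf_digraph H by fact
  let ?X = "verts H - {r}"
  have f_arc: "f x \<in> arcs H" "tail H (f x) = x" if "x \<in> ?X" for x
    using f that by (auto simp: acyclic_choices_def PiE_iff)
  have "f ` ?X \<subseteq> arcs H" using f_arc by blast
  then interpret T: wf_digraph ?T by unfold_locales auto
  have span: "spanning ?T H"
    using f_arc H.wf_digraph_axioms T.wf_digraph_axioms
    by (auto simp: spanning_def subgraph_def compatible_def)
  have "\<exists>p. T.awalk v p r" if v: "v \<in> verts H" for v
  proof -
    have "\<exists>z \<in> {r}. (v, z) \<in> (succ_rel ?X (head H) f)\<^sup>*"
      using f v f_arc \<open>finite (verts H)\<close>
      by (intro succ_rel_reaches_sink) (auto simp: acyclic_choices_def)
    then have "(v, r) \<in> (succ_rel ?X (head H) f)\<^sup>*" by simp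
    then show ?thesis
    proof (induction rule: converse_rtrancl_induct)
      case base
      then show ?case using r by (auto simp: T.awalk_Nil_iff intro!: exI[of _ "[]"])
    next
      case (step x y)
      then obtain p where "T.awalk y p r" by blast
      then have "T.awalk x (f x # p) r"
        using step(1) f_arc by (auto simp: T.awalk_Cons_iff succ_rel_iff)
      then show ?case by blast
    qed
  qed
  moreover have "p = q" if "T.awalk v p r" "T.awalk v q r" for v p q
  proof -
    have arc: "tail H a \<noteq> r" "f (tail H a) = a" if a: "a \<in> f ` ?X" for a
    proof -
      from a obtain x where "x \<in> ?X" "a = f x" by blast
      then show "tail H a \<noteq> r" "f (tail H a) = a" using f_arc(2)[of x] by auto
    qed
    have Cons_iff: "T.awalk x (a # p) y \<longleftrightarrow> a \<in> f ` ?X \<and> x = tail H a \<and> T.awalk (head H a) p y" for x a p y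
      by (simp add: T.awalk_Cons_iff)
    show ?thesis using that
    proof (induction p arbitrary: v q)
      case Nil
      then show ?case using arc by (cases q) (auto simp only: T.awalk_Nil_iff Cons_iff)
    next
      case (Cons a p)
      then have a: "a \<in> f ` ?X" "v = tail H a" "T.awalk (head H a) p r"
        by (simp_all only: Cons_iff)
      then obtain b q' where q: "q = b # q'" "b \<in> f ` ?X" "v = tail H b" "T.awalk (head H b) q' r"
        using Cons.prems(2) arc by (cases q) (auto simp only: T.awalk_Nil_iff Cons_iff)
      then have "a = b" using a arc by metis
      then show ?case using Cons.IH a q by simp
    qed
  qed
  ultimately show ?thesis using span r unfolding oriented_spanning_tree_def by auto
qed

text \<open>Each defect would produce a second walk to \<open>r\<close>: an arc out of
  \<open>r\<close> competes with the empty walk, two arcs with the same tail start different walks,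
  and a cycle can be prepended to a walk.\<close>

lemma oriented_spanning_treeE:
  fixes H :: "('a, 'b) pre_digraph"
  assumes "oriented_spanning_tree H r T"
  obtains f where "r \<in> verts H"
    "f \<in> acyclic_choices (verts H - {r}) (out_arcs H) (head H)"
    "T = H\<lparr>arcs := f ` (verts H - {r})\<rparr>"
proof -
  let ?X = "verts H - {r}"
  have span: "spanning T H" and r: "r \<in> verts T"
    and uniq: "\<And>v. v \<in> verts T \<Longrightarrow> \<exists>!p. pre_digraph.awalk T v p r"
    using assms by (auto simp: oriented_spanning_tree_def)
  interpret T: wf_digraph T using span by (auto simp: spanning_def subgraph_def)
  have T: "verts T = verts H" "tail T = tail H" "head T = head H" "arcs T \<subseteq> arcs H"
    using span by (auto simp: spanning_def subgraph_def compatible_def)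
  have walk_eq: "p = q" if "T.awalk v p r" "T.awalk v q r" for v p q
    using uniq[of v] that by blast
  have walk_ex: "\<exists>p. T.awalk v p r" if "v \<in> verts T" for v using uniq[OF that] by blast
  have no_out: "tail T a \<noteq> r" if a: "a \<in> arcs T" for a
  proof
    assume "tail T a = r"
    moreover obtain p where "T.awalk (head T a) p r" using walk_ex a by force
    ultimately have "T.awalk r (a # p) r" using a by (simp add: T.awalk_Cons_iff)
    then show False using walk_eq[of r "[]" "a # p"] r by (simp add: T.awalk_Nil_iff)
  qed
  have out_uniq: "a = b" if "a \<in> arcs T" "b \<in> arcs T" "tail T a = tail T b" for a b
  proof -
    from that obtain p q where "T.awalk (head T a) p r" "T.awalk (head T b) q r"
      using walk_ex by (meson T.head_in_verts)
    then have "T.awalk (tail T a) (a # p) r" "T.awalk (tail T a) (b # q) r"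
      using that by (simp_all add: T.awalk_Cons_iff)
    then show ?thesis using walk_eq by blast
  qed
  have out_ex: "\<exists>a \<in> arcs T. tail T a = v" if v: "v \<in> ?X" for v
  proof -
    obtain p where p: "T.awalk v p r" using walk_ex v T by auto
    then show ?thesis using v by (cases p) (auto simp: T.awalk_simps)
  qed
  define f where "f = (\<lambda>x\<in>?X. SOME a. a \<in> arcs T \<and> tail T a = x)"
  have f: "f x \<in> arcs T" "tail T (f x) = x" if "x \<in> ?X" for x
    using someI_ex[of "\<lambda>a. a \<in> arcs T \<and> tail T a = x"] out_ex[OF that] that
    by (auto simp: f_def)
  have img: "f ` ?X = arcs T"
  proof (intro equalityI subsetI)
    fix a assume a: "a \<in> arcs T"
    then have tail: "tail T a \<in> ?X" using no_out T.tail_in_verts T(1) by simp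
    then have "f (tail T a) = a" using f out_uniq a by blast
    then show "a \<in> f ` ?X" using tail by (metis imageI)
  qed (use f in auto)
  have "acyclic (succ_rel ?X (head H) f)"
  proof (rule acyclicI, intro allI notI)
    fix v assume v: "(v, v) \<in> (succ_rel ?X (head H) f)\<^sup>+"
    have "succ_rel ?X (head H) f \<subseteq> arcs_ends T"
      using f by (force simp: succ_rel_def arcs_ends_def arc_to_ends_def T image_iff)
    then have "(v, v) \<in> (arcs_ends T)\<^sup>+" using v trancl_mono by blast
    then obtain p where p: "T.awalk v p v" "p \<noteq> []" by (auto simp: T.reachable1_awalk)
    then obtain q where q: "T.awalk v q r" using walk_ex by blast
    have "p @ q = q" using walk_eq[OF T.awalk_appendI[OF p(1) q] q] .
    then show False using p(2) by simp
  qed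
  moreover have "f \<in> Pi\<^sub>E ?X (out_arcs H)"
    using f T by (auto simp: PiE_iff f_def)
  ultimately have "f \<in> acyclic_choices ?X (out_arcs H) (head H)"
    by (simp add: acyclic_choices_def)
  moreover have "T = H\<lparr>arcs := f ` ?X\<rparr>" using T img by (intro pre_digraph.equality) auto
  ultimately show ?thesis using that r T by simp
qed

text \<open>A tree determines its pair \<open>(r, f)\<close>: \<open>r\<close> is the only vertex
  that is not the tail of an arc, and \<open>f x\<close> is the arc with tail
  \<open>x\<close>.\<close>

lemma sum_oriented_spanning_trees:
  fixes H :: "('a, 'b) pre_digraph" and w :: "'b \<Rightarrow> 'c::comm_ring_1"
  assumes "fin_digraph H"
  shows "(\<Sum>T \<in> oriented_spanning_trees H. \<Prod>a \<in> arcs T. w a) =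
    tree_sum (verts H) (out_arcs H) (head H) w"
proof -
  interpret fin_digraph H by fact
  let ?C = "\<lambda>r. acyclic_choices (verts H - {r}) (out_arcs H) (head H)"
  let ?S = "SIGMA r:verts H. ?C r"
  let ?T = "\<lambda>(r, f). H\<lparr>arcs := f ` (verts H - {r})\<rparr>"
  have tail_f: "tail H (f x) = x" if "f \<in> ?C r" "x \<in> verts H - {r}" for r f x
    using that by (auto simp: acyclic_choices_def PiE_iff)
  have img: "oriented_spanning_trees H = ?T ` ?S"
  proof (intro equalityI subsetI)
    fix T assume "T \<in> oriented_spanning_trees H"
    then obtain r where "oriented_spanning_tree H r T" by (auto simp: oriented_spanning_trees_def)
    then show "T \<in> ?T ` ?S" by (rule oriented_spanning_treeE) force
  next
    fix T assume "T \<in> ?T ` ?S"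
    then show "T \<in> oriented_spanning_trees H"
      using oriented_spanning_treeI[OF wf_digraph_axioms finite_verts]
      by (auto simp: oriented_spanning_trees_def)
  qed
  have inj: "inj_on ?T ?S"
  proof (rule inj_onI, clarify)
    fix r f r' f'
    assume r: "r \<in> verts H" "r' \<in> verts H" and f: "f \<in> ?C r" "f' \<in> ?C r'"
      and "H\<lparr>arcs := f ` (verts H - {r})\<rparr> = H\<lparr>arcs := f' ` (verts H - {r'})\<rparr>"
    then have eq: "f ` (verts H - {r}) = f' ` (verts H - {r'})"
      by (metis pre_digraph.select_convs(2) pre_digraph.surjective pre_digraph.update_convs(2))
    have tails: "tail H ` f ` (verts H - {r}) = verts H - {r}" if "f \<in> ?C r" for f r
      using tail_f[OF that] by (force simp: image_image)
    have "verts H - {r} = verts H - {r'}" using tails[OF f(1)] tails[OF f(2)] eq by simp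
    then have "r = r'" using r by auto
    moreover have "f = f'"
    proof (rule PiE_ext)
      show "f \<in> Pi\<^sub>E (verts H - {r}) (out_arcs H)" "f' \<in> Pi\<^sub>E (verts H - {r}) (out_arcs H)"
        using f \<open>r = r'\<close> by (auto simp: acyclic_choices_def)
      fix x assume x: "x \<in> verts H - {r}"
      then obtain y where "y \<in> verts H - {r'}" "f x = f' y" using eq by blast
      then show "f x = f' x" using tail_f[OF f(1) x] tail_f[OF f(2)] by metis
    qed
    ultimately show "r = r' \<and> f = f'" by simp
  qed
  have prod_eq: "(\<Prod>a \<in> f ` (verts H - {r}). w a) = (\<Prod>x \<in> verts H - {r}. w (f x))"
    if "f \<in> ?C r" for r f
    using tail_f[OF that] by (subst prod.reindex) (auto intro: inj_on_inverseI)
  have fin: "finite (?C r)" for r by (intro finite_acyclic_choices) auto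
  have "(\<Sum>T \<in> oriented_spanning_trees H. \<Prod>a \<in> arcs T. w a) =
      (\<Sum>(r, f) \<in> ?S. \<Prod>x \<in> verts H - {r}. w (f x))"
    unfolding img by (subst sum.reindex[OF inj]) (auto intro!: sum.cong simp: prod_eq)
  also have "\<dots> = tree_sum (verts H) (out_arcs H) (head H) w"
    unfolding tree_sum_def forest_sum_def using fin by (subst sum.Sigma) auto
  finally show ?thesis .
qed

section \<open>From the line graph back to the graph\<close>

text \<open>The arcs \<open>(e, f)\<close> of the line graph carry their tail, so different vertices
  never share a label. Dropping the tail gives edges with the same head in \<open>G\<close> the same
  labels, as merging demands.\<close>

lemma forest_sum_tag:
  fixes h :: "'b \<Rightarrow> 'a" and w :: "'b \<Rightarrow> 'c::comm_ring_1"
  shows "forest_sum X (\<lambda>x. {x} \<times> B x) (h \<circ> snd) (w \<circ> snd) = forest_sum X B h w"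
proof -
  have rel: "succ_rel X (h \<circ> snd) g = succ_rel X h (\<lambda>x\<in>X. snd (g x))" for g :: "'a \<Rightarrow> 'a \<times> 'b"
    by (auto simp: succ_rel_def)
  show ?thesis
    unfolding forest_sum_def
    by (rule sum.reindex_bij_witness[where i = "\<lambda>f. \<lambda>x\<in>X. (x, f x)" and
          j = "\<lambda>g. \<lambda>x\<in>X. snd (g x)"])
      (auto simp: acyclic_choices_def rel PiE_iff fun_eq_iff extensional_def
        prod_eq_iff mem_Times_iff cong: restrict_cong)
qed

lemma acyclic_choices_cong:
  "(\<And>x. x \<in> X \<Longrightarrow> B x = B' x) \<Longrightarrow> acyclic_choices X B h = acyclic_choices X B' h"
  by (simp add: acyclic_choices_def cong: PiE_cong)

lemma fin_digraph_line_digraph: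
  assumes "fin_digraph G"
  shows "fin_digraph (line_digraph G)"
proof -
  interpret fin_digraph G by fact
  have "finite {(e, f). e \<in> arcs G \<and> f \<in> arcs G \<and> head G e = tail G f}"
    by (rule finite_subset[of _ "arcs G \<times> arcs G"]) auto
  then show ?thesis by unfold_locales (auto simp: line_digraph_def)
qed

theorem theorem3p1:
  fixes G :: "('v, 'e) pre_digraph"
  assumes "fin_digraph G"
    and "\<And>v. v \<in> verts G \<Longrightarrow> in_degree G v > 0"
  shows "kappa_vertex (line_digraph G) =
    kappa_edge G * (\<Prod>v \<in> verts G. (\<Sum>e \<in> out_arcs G v. indet e) ^ (in_degree G v - 1))"
proof -
  interpret fin_digraph G by fact
  let ?B = "out_arcs G \<circ> head G"
  \<comment> \<open>By positive indegree every vertex is the head of an edge, so the quotient of the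
    edge set by \<open>head G\<close> is all of \<open>verts G\<close>.\<close>
  have heads: "head G ` arcs G = verts G"
    using assms(2) by (force simp: in_degree_def card_gt_0_iff in_arcs_def)
  have out: "out_arcs (line_digraph G) e = {e} \<times> ?B e" if "e \<in> arcs G" for e
    using that by (auto simp: line_digraph_def out_arcs_def)
  have "kappa_vertex (line_digraph G) =
      tree_sum (arcs G) (out_arcs (line_digraph G)) snd (indet \<circ> snd)"
    using sum_oriented_spanning_trees[OF fin_digraph_line_digraph[OF assms(1)], of "indet \<circ> snd"]
    by (simp add: kappa_vertex_def line_digraph_def)
  also have "\<dots> = tree_sum (arcs G) ?B id indet"
    unfolding tree_sum_def
  proof (intro sum.cong refl)
    fix r
    have "forest_sum (arcs G - {r}) (out_arcs (line_digraph G)) snd (indet \<circ> snd) =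
        forest_sum (arcs G - {r}) (\<lambda>e. {e} \<times> ?B e) (id \<circ> snd) (indet \<circ> snd)"
    proof -
      have "acyclic_choices (arcs G - {r}) (out_arcs (line_digraph G)) snd =
          acyclic_choices (arcs G - {r}) (\<lambda>e. {e} \<times> ?B e) snd"
        by (rule acyclic_choices_cong) (use out in auto)
      then show ?thesis by (simp add: forest_sum_def)
    qed
    then show "forest_sum (arcs G - {r}) (out_arcs (line_digraph G)) snd (indet \<circ> snd) =
        forest_sum (arcs G - {r}) ?B id indet"
      by (simp only: forest_sum_tag)
  qed
  \<comment> \<open>A label \<open>f\<close> is its own head in the line graph, whence
    \<open>id\<close>. In the quotient by \<open>head G\<close> its head becomes
    \<open>head G f\<close>, so the quotient is \<open>G\<close> itself.\<close>
  also have "\<dots> = (\<Prod>v \<in> verts G. sum indet (out_arcs G v) ^ (card {e \<in> arcs G. head G e = v} - 1)) *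
      tree_sum (verts G) (out_arcs G) (head G) indet"
    by (subst tree_sum_quotient) (auto simp: heads out_arcs_def)
  also have "tree_sum (verts G) (out_arcs G) (head G) indet = kappa_edge G"
    using sum_oriented_spanning_trees[OF assms(1), of indet] by (simp add: kappa_edge_def)
  finally show ?thesis by (simp add: in_degree_def in_arcs_def mult.commute)
qed

end
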